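(* Let $\mathcal{X}$ be a non-empty finite set and $n\geq1$ an integer. A set $\mathcal{A}^n\subseteq\mathcal{G}(\mathcal{X}^n)$ of gambles on $\mathcal{X}^n$ can be extended to a coherent, exchangeable and time-consistent family (i.e. there is a coherent, exchangeable and time-consistent family $(\mathcal{R}^k)_{k\geq1}$ with $\mathcal{A}^n\subseteq\mathcal{R}^n$) if and only if $\mathrm{Mn}^n(\mathcal{A}^n)$ avoids Bernstein non-positivity. In that case the most conservative (i.e. element-wise smallest) such family has frequency representation $\mathcal{E}_{\mathrm{Be}}\bigl(\mathrm{Mn}^n(\mathcal{A}^n)\bigr)$.
   Context: A gamble on a non-empty set $\Omega$ is a bounded function $\Omega\to\mathbb{R}$; $\mathcal{G}(\Omega)$ is the linear space of all gambles on $\Omega$. Write $f\geq g$ for the pointwise ordering, and $f>g$ iff $f\geq g$ and $f\neq g$. A set $\mathcal{R}\subseteq\mathcal{G}(\Omega)$ is coherent if: $0\notin\mathcal{R}$; $f>0$ implies $f\in\mathcal{R}$; $f\in\mathcal{R}$ and $\lambda>0$ imply $\lambda f\in\mathcal{R}$; $f_1,f_2\in\mathcal{R}$ implies $f_1+f_2\in\mathcal{R}$. For a permutation $\pi$ of $\{1,\dots,n\}$ put $\pi(x_1,\dots,x_n)=(x_{\pi(1)},\dots,x_{\pi(n)})$ and $\pi^tf=f\circ\pi$. A coherent set $\mathcal{R}\subseteq\mathcal{G}(\mathcal{X}^n)$ is exchangeable if $h+(f-\pi^tf)\in\mathcal{R}$ for all $h\in\mathcal{R}$, $f\in\mathcal{G}(\mathcal{X}^n)$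 and all permutations $\pi$. For $1\leq n_1\leq n_2$ and $f\in\mathcal{G}(\mathcal{X}^{n_1})$, $\mathrm{ext}_{n_1}^{n_2}(f)(x_1,\dots,x_{n_2})=f(x_1,\dots,x_{n_1})$. A family $(\mathcal{R}^k)_{k\geq1}$ with $\mathcal{R}^k\subseteq\mathcal{G}(\mathcal{X}^k)$ is coherent, exchangeable and time-consistent if each $\mathcal{R}^k$ is coherent and exchangeable and $\mathrm{ext}_{n_1}^{n_2}(\mathcal{R}^{n_1})=\mathcal{R}^{n_2}\cap\mathrm{ext}_{n_1}^{n_2}(\mathcal{G}(\mathcal{X}^{n_1}))$ for all $1\leq n_1\leq n_2$. For $n\geq0$, $\mathcal{N}^n=\{m\in\mathbb{Z}_{\geq0}^{\mathcal{X}}:\sum_zm_z=n\}$; for $m\in\mathcal{N}^n$, $[m]$ is the set of $x\in\mathcal{X}^n$ in which each $z\in\mathcal{X}$ occurs exactly $m_z$ times; $|[m]|=n!/\prod_zm_z!$. $\Sigma_{\mathcal{X}}=\{\theta\in\mathbb{R}^{\mathcal{X}}:\theta\geq0,\sum_x\theta_x=1\}$; $\mathcal{V}(\Sigma_{\mathcal{X}})$ is the linear space of polynomial functions on $\Sigma_{\mathcal{X}}$, and $\deg(p)$ is the smallest degree of a polynomial representing $p$ on $\Sigma_{\mathcal{X}}$ (with $\deg(0)=0$); $B_m(\theta)=|[m]|\prod_z\theta_z^{m_z}$ ($0^0=1$). For $n\geq\deg(p)$ there is a unique $b_p^n\in\mathcal{G}(\mathcal{N}^n)$ with $p=\sum_{m\in\mathcal{N}^n}b_p^n(m)B_m$.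 For $f\in\mathcal{G}(\mathcal{X}^n)$, $\mathrm{Mn}^n(f)=\sum_{m\in\mathcal{N}^n}\bigl(\frac1{|[m]|}\sum_{y\in[m]}f(y)\bigr)B_m$. The frequency representation of a coherent, exchangeable and time-consistent family $(\mathcal{R}^k)_{k\geq1}$ is $\bigcup_{k\geq1}\mathrm{Mn}^k(\mathcal{R}^k)$. For a set $\mathcal{A}$ of polynomials, $\mathrm{posi}(\mathcal{A})=\{\sum_{k=1}^n\lambda_kp_k:n\geq1,p_k\in\mathcal{A},\lambda_k>0\}$; $\mathcal{A}$ avoids Bernstein non-positivity if no $p\in\mathrm{posi}(\mathcal{A})$ satisfies $b_p^r\leq0$ for some $r\geq\deg(p)$. A set $\mathcal{H}\subseteq\mathcal{V}(\Sigma_{\mathcal{X}})$ is Bernstein coherent if for all $p,p_1,p_2\in\mathcal{V}(\Sigma_{\mathcal{X}})$ and real $\lambda>0$: $0\notin\mathcal{H}$; if $b_p^r>0$ for some $r\geq\deg(p)$ then $p\in\mathcal{H}$; $p\in\mathcal{H}$ implies $\lambda p\in\mathcal{H}$; $p_1,p_2\in\mathcal{H}$ implies $p_1+p_2\in\mathcal{H}$. The Bernstein natural extension $\mathcal{E}_{\mathrm{Be}}(\mathcal{A})$ is the intersection of all Bernstein coherent sets that include $\mathcal{A}$ (equal to $\mathcal{V}(\Sigma_{\mathcal{X}})$ if there are none). *)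

theory Defs
  imports
    "HOL-Library.Poly_Mapping"
    "HOL-Combinatorics.Permutations"
    "HOL-Analysis.Elementary_Metric_Spaces"
begin

text \<open>
  The category set \<open>\<X>\<close> is a type \<open>'x\<close> of class \<open>finite\<close>. A function whose domain is a
  set (a set of sequences of a given length, of count vectors, or the simplex) is a
  HOL function that is \<open>0\<close> outside that set. Hence equality, \<open>\<le>\<close>, \<open><\<close> and pointwise linear
  operations on HOL functions agree with those of functions on the set, and \<open>f < g\<close> is
  \<open>f \<le> g \<and> f \<noteq> g\<close>.
\<close>

definition gambles :: "'a set \<Rightarrow> ('a \<Rightarrow> real) set" where
  "gambles \<Omega> = {f. (\<forall>x. x \<notin> \<Omega> \<longrightarrow> f x = 0) \<and> bounded (f ` \<Omega>)}"

definition coherent_set :: "'a set \<Rightarrow> ('a \<Rightarrow> real) set \<Rightarrow> bool" where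
  "coherent_set \<Omega> R \<longleftrightarrow>
     R \<subseteq> gambles \<Omega> \<and>
     (\<lambda>_. 0) \<notin> R \<and>
     (\<forall>f\<in>gambles \<Omega>. f > (\<lambda>_. 0) \<longrightarrow> f \<in> R) \<and>
     (\<forall>f\<in>R. \<forall>c>0. (\<lambda>x. c * f x) \<in> R) \<and>
     (\<forall>f\<in>R. \<forall>g\<in>R. (\<lambda>x. f x + g x) \<in> R)"

text \<open>A sequence in \<open>\<X>\<^sup>n\<close> is a list of length \<open>n\<close>, with positions numbered from \<open>0\<close>.\<close>

definition seqs :: "nat \<Rightarrow> 'x list set" where
  "seqs n = {x. length x = n}"

text \<open>
  \<open>permute_list \<pi> x\<close> is the list with entry \<open>x ! \<pi> i\<close> at position \<open>i\<close>; it preserves the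
  length, so \<open>f \<circ> permute_list \<pi>\<close> is again \<open>0\<close> outside \<open>seqs n\<close>.
\<close>

definition exchangeable :: "nat \<Rightarrow> ('x list \<Rightarrow> real) set \<Rightarrow> bool" where
  "exchangeable n R \<longleftrightarrow>
     (\<forall>h\<in>R. \<forall>f\<in>gambles (seqs n). \<forall>\<pi>. \<pi> permutes {..<n} \<longrightarrow>
        (\<lambda>x. h x + (f x - (f \<circ> permute_list \<pi>) x)) \<in> R)"

definition extend_gamble :: "nat \<Rightarrow> nat \<Rightarrow> ('x list \<Rightarrow> real) \<Rightarrow> 'x list \<Rightarrow> real" where
  "extend_gamble n1 n2 f = (\<lambda>x. if x \<in> seqs n2 then f (take n1 x) else 0)"

text \<open>Families are indexed by \<open>k \<ge> 1\<close>; the value at index \<open>0\<close> is never used.\<close>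

definition coh_exch_time_consistent :: "(nat \<Rightarrow> ('x list \<Rightarrow> real) set) \<Rightarrow> bool" where
  "coh_exch_time_consistent R \<longleftrightarrow>
     (\<forall>k\<ge>1. coherent_set (seqs k) (R k) \<and> exchangeable k (R k)) \<and>
     (\<forall>n1 n2. 1 \<le> n1 \<and> n1 \<le> n2 \<longrightarrow>
        extend_gamble n1 n2 ` R n1 = R n2 \<inter> extend_gamble n1 n2 ` gambles (seqs n1))"

definition extends_to ::
  "nat \<Rightarrow> ('x list \<Rightarrow> real) set \<Rightarrow> (nat \<Rightarrow> ('x list \<Rightarrow> real) set) \<Rightarrow> bool" where
  "extends_to n A R \<longleftrightarrow> coh_exch_time_consistent R \<and> A \<subseteq> R n"

definition most_conservative_extension ::
  "nat \<Rightarrow> ('x list \<Rightarrow> real) set \<Rightarrow> (nat \<Rightarrow> ('x list \<Rightarrow> real) set) \<Rightarrow> bool" where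
  "most_conservative_extension n A R \<longleftrightarrow>
     extends_to n A R \<and> (\<forall>S. extends_to n A S \<longrightarrow> (\<forall>k\<ge>1. R k \<subseteq> S k))"

definition prob_simplex :: "('x::finite \<Rightarrow> real) set" where
  "prob_simplex = {\<theta>. (\<forall>x. \<theta> x \<ge> 0) \<and> (\<Sum>x\<in>UNIV. \<theta> x) = 1}"

text \<open>
  Formal polynomials over the indeterminates \<open>'x\<close> are finitely supported maps from
  exponent vectors to real coefficients.
\<close>

type_synonym 'x mpoly = "('x \<Rightarrow>\<^sub>0 nat) \<Rightarrow>\<^sub>0 real"

definition total_degree :: "('x::finite) mpoly \<Rightarrow> nat" where
  "total_degree P = Max (insert 0 ((\<lambda>\<alpha>. \<Sum>z\<in>UNIV. Poly_Mapping.lookup \<alpha> z) ` Poly_Mapping.keys P))"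

definition poly_fun :: "('x::finite) mpoly \<Rightarrow> ('x \<Rightarrow> real) \<Rightarrow> real" where
  "poly_fun P = (\<lambda>\<theta>. if \<theta> \<in> prob_simplex
     then \<Sum>\<alpha>\<in>Poly_Mapping.keys P. Poly_Mapping.lookup P \<alpha> * (\<Prod>z\<in>UNIV. \<theta> z ^ Poly_Mapping.lookup \<alpha> z) else 0)"

definition simplex_polys :: "(('x::finite \<Rightarrow> real) \<Rightarrow> real) set" where
  "simplex_polys = range poly_fun"

definition poly_deg :: "(('x::finite \<Rightarrow> real) \<Rightarrow> real) \<Rightarrow> nat" where
  "poly_deg p = (LEAST d. \<exists>P. poly_fun P = p \<and> total_degree P = d)"

definition count_vectors :: "nat \<Rightarrow> ('x::finite \<Rightarrow> nat) set" where
  "count_vectors n = {m. (\<Sum>z\<in>UNIV. m z) = n}"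

definition count_class :: "('x::finite \<Rightarrow> nat) \<Rightarrow> 'x list set" where
  "count_class m = {x \<in> seqs (\<Sum>z\<in>UNIV. m z). \<forall>z. count_list x z = m z}"

definition bernstein_basis :: "('x::finite \<Rightarrow> nat) \<Rightarrow> ('x \<Rightarrow> real) \<Rightarrow> real" where
  "bernstein_basis m = (\<lambda>\<theta>. if \<theta> \<in> prob_simplex
     then real (card (count_class m)) * (\<Prod>z\<in>UNIV. \<theta> z ^ m z) else 0)"

text \<open>
  For a polynomial function \<open>p\<close> the expansion exists and is unique whenever
  \<open>n \<ge> poly_deg p\<close>; the definition is only used in that case.
\<close>

definition bernstein_coeffs ::
  "nat \<Rightarrow> (('x::finite \<Rightarrow> real) \<Rightarrow> real) \<Rightarrow> ('x \<Rightarrow> nat) \<Rightarrow> real" where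
  "bernstein_coeffs n p = (THE b. b \<in> gambles (count_vectors n) \<and>
     p = (\<lambda>\<theta>. \<Sum>m\<in>count_vectors n. b m * bernstein_basis m \<theta>))"

definition Mn :: "nat \<Rightarrow> ('x::finite list \<Rightarrow> real) \<Rightarrow> ('x \<Rightarrow> real) \<Rightarrow> real" where
  "Mn n f = (\<lambda>\<theta>. \<Sum>m\<in>count_vectors n.
     (1 / real (card (count_class m)) * (\<Sum>y\<in>count_class m. f y)) * bernstein_basis m \<theta>)"

definition frequency_representation ::
  "(nat \<Rightarrow> ('x::finite list \<Rightarrow> real) set) \<Rightarrow> (('x \<Rightarrow> real) \<Rightarrow> real) set" where
  "frequency_representation R = (\<Union>k\<in>{1..}. Mn k ` R k)"

definition posi :: "('a \<Rightarrow> real) set \<Rightarrow> ('a \<Rightarrow> real) set" where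
  "posi A = {\<lambda>\<theta>. \<Sum>k=1..n. c k * p k \<theta> | (n::nat) c p.
     n \<ge> 1 \<and> (\<forall>k\<in>{1..n}. p k \<in> A \<and> c k > 0)}"

definition avoids_bernstein_nonpositivity ::
  "(('x::finite \<Rightarrow> real) \<Rightarrow> real) set \<Rightarrow> bool" where
  "avoids_bernstein_nonpositivity A \<longleftrightarrow>
     \<not> (\<exists>p\<in>posi A. \<exists>r\<ge>poly_deg p. bernstein_coeffs r p \<le> (\<lambda>_. 0))"

definition bernstein_coherent :: "(('x::finite \<Rightarrow> real) \<Rightarrow> real) set \<Rightarrow> bool" where
  "bernstein_coherent H \<longleftrightarrow>
     H \<subseteq> simplex_polys \<and>
     (\<lambda>_. 0) \<notin> H \<and>
     (\<forall>p\<in>simplex_polys. (\<exists>r\<ge>poly_deg p. bernstein_coeffs r p > (\<lambda>_. 0)) \<longrightarrow> p \<in> H) \<and>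
     (\<forall>p\<in>H. \<forall>c>0. (\<lambda>\<theta>. c * p \<theta>) \<in> H) \<and>
     (\<forall>p\<in>H. \<forall>q\<in>H. (\<lambda>\<theta>. p \<theta> + q \<theta>) \<in> H)"

text \<open>
  The intersection is taken inside \<open>simplex_polys\<close>, which is the value when there is no
  Bernstein coherent superset.
\<close>

definition bernstein_natural_extension ::
  "(('x::finite \<Rightarrow> real) \<Rightarrow> real) set \<Rightarrow> (('x \<Rightarrow> real) \<Rightarrow> real) set" where
  "bernstein_natural_extension A =
     simplex_polys \<inter> \<Inter>{H. bernstein_coherent H \<and> A \<subseteq> H}"

end

theory Submission
  imports Defs
begin

text \<open>
  Evaluated at \<open>\<theta>\<close>, the polynomial \<open>Mn n f\<close> is the expectation of \<open>f\<close> under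
  independent draws from \<open>\<theta>\<close>. Hence \<open>Mn\<close> forgets both the order of the draws and any
  trailing draws on which a gamble does not depend, and by uniqueness of Bernstein
  expansions the kernel of \<open>Mn n\<close> consists of the gambles with mean \<open>0\<close> on every count
  class. These are averages of differences \<open>f - \<pi>\<^sup>tf\<close>, so an exchangeable coherent set is
  a full preimage under \<open>Mn n\<close>, and time consistency glues these preimages together: a coherent,
  exchangeable and time-consistent family is the family of preimages of a Bernstein
  coherent set. It remains to extend \<open>Mn n ` A\<close> to a Bernstein coherent set, by adjoining
  to its positive hull the cone of polynomials with positive Bernstein coefficients.
\<close>

section \<open>Sequences and count vectors\<close>

lemma gambles_finite: "finite S \<Longrightarrow> gambles S = {f. \<forall>x. x \<notin> S \<longrightarrow> f x = 0}"
  by (auto simp: gambles_def intro: finite_imp_bounded)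

lemma finite_seqs [simp]: "finite (seqs n :: 'x::finite list set)"
  by (rule finite_subset[OF _ finite_lists_length_eq[of "UNIV :: 'x set" n]]) (auto simp: seqs_def)

lemma gambles_seqs: "gambles (seqs n) = {f :: 'x::finite list \<Rightarrow> real. \<forall>x. length x \<noteq> n \<longrightarrow> f x = 0}"
  by (subst gambles_finite[OF finite_seqs]) (simp add: seqs_def)

lemma sum_count_list: "(\<Sum>z\<in>UNIV. count_list x z) = length (x :: 'x::finite list)"
  by (rule sum_count_set) auto

lemma count_class_eq: "count_class m = {x. count_list x = m}"
  by (auto simp: count_class_def seqs_def fun_eq_iff simp flip: sum_count_list)

text \<open>Over a finite set of categories every count vector is the count function of a multiset,
  and listing that multiset gives a member. This is what permits cancelling cardinalities of count
  classes later on.\<close>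

lemma count_class_nonempty: "count_class m \<noteq> {}" for m :: "'x::finite \<Rightarrow> nat"
proof -
  obtain x where "mset x = Abs_multiset m" using ex_mset by blast
  moreover have "count (Abs_multiset m) = m"
    by (rule count_Abs_multiset) auto
  ultimately have "count_list x = m"
    using count_mset[of x] by auto
  then show ?thesis by (auto simp: count_class_eq)
qed

lemma finite_count_class [simp]: "finite (count_class m)" for m :: "'x::finite \<Rightarrow> nat"
  by (rule finite_subset[OF _ finite_seqs[of "\<Sum>z\<in>UNIV. m z"]]) (auto simp: count_class_def)

lemma count_list_in_count_vectors [simp]: "count_list x \<in> count_vectors n \<longleftrightarrow> length x = n"
  by (simp add: count_vectors_def sum_count_list)

lemma count_list_image_seqs: "count_list ` seqs n = (count_vectors n :: ('x::finite \<Rightarrow> nat) set)"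
proof -
  have "m \<in> count_list ` seqs n" if "m \<in> count_vectors n" for m :: "'x \<Rightarrow> nat"
    using count_class_nonempty[of m] that
    by (auto simp: count_class_eq count_vectors_def seqs_def sum_count_list)
  then show ?thesis
    by (auto simp: count_vectors_def seqs_def sum_count_list)
qed

lemma finite_count_vectors [simp]: "finite (count_vectors n :: ('x::finite \<Rightarrow> nat) set)"
  by (simp flip: count_list_image_seqs)

lemma gambles_count_vectors:
  "gambles (count_vectors n) = {b :: ('x::finite \<Rightarrow> nat) \<Rightarrow> real. \<forall>m. m \<notin> count_vectors n \<longrightarrow> b m = 0}"
  by (subst gambles_finite) auto

definition class_mean :: "('x::finite list \<Rightarrow> real) \<Rightarrow> ('x \<Rightarrow> nat) \<Rightarrow> real" where
  "class_mean f m = 1 / real (card (count_class m)) * (\<Sum>y\<in>count_class m. f y)"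

lemma class_mean_gamble: "f \<in> gambles (seqs n) \<Longrightarrow> class_mean f \<in> gambles (count_vectors n)"
  by (force simp: gambles_seqs gambles_count_vectors class_mean_def count_class_eq
      intro!: sum.neutral)

text \<open>A function of the counts is constant on each count class. Composition with
  \<open>count_list\<close> is thus a right inverse of averaging and realises any coefficient vector
  by an order-independent gamble.\<close>

lemma class_mean_lift: "class_mean (b \<circ> count_list) = b" for b :: "('x::finite \<Rightarrow> nat) \<Rightarrow> real"
proof
  fix m :: "'x \<Rightarrow> nat"
  have "(\<Sum>y\<in>count_class m. b (count_list y)) = (\<Sum>y\<in>count_class m. b m)"
    by (rule sum.cong) (auto simp: count_class_eq)
  then show "class_mean (b \<circ> count_list) m = b m"
    using count_class_nonempty[of m] by (simp add: class_mean_def)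
qed

lemma lift_gamble:
  "b \<in> gambles (count_vectors n) \<Longrightarrow> b \<circ> count_list \<in> gambles (seqs n :: 'x::finite list set)"
  by (auto simp: gambles_seqs gambles_count_vectors)

section \<open>The multinomial map as an expectation under independent draws\<close>

lemma Mn_class_mean: "Mn n f = (\<lambda>\<theta>. \<Sum>m\<in>count_vectors n. class_mean f m * bernstein_basis m \<theta>)"
  by (simp add: Mn_def class_mean_def)

lemma prod_list_map_count: "(\<Prod>z\<leftarrow>x. \<theta> z) = (\<Prod>z\<in>UNIV. \<theta> z ^ count_list x z)"
  for \<theta> :: "'x::finite \<Rightarrow> real"
proof (induction x)
  case (Cons y x)
  have "(\<Prod>z\<in>UNIV. \<theta> z ^ count_list (y # x) z) =
      (\<Prod>z\<in>UNIV. (if z = y then \<theta> z else 1) * \<theta> z ^ count_list x z)"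
    by (rule prod.cong) auto
  with Cons show ?case by (simp add: prod.distrib)
qed simp

text \<open>The class size in \<open>bernstein_basis\<close> cancels the denominator of the class
  mean, so each sequence is weighted by its probability under independent draws from \<theta>.
  Linearity and the invariances of \<open>Mn\<close> are read off from this form.\<close>

lemma Mn_eq: "Mn n f \<theta> =
  (if \<theta> \<in> prob_simplex then \<Sum>x\<in>seqs n. f x * (\<Prod>z\<leftarrow>x. \<theta> z) else 0)"
proof (cases "\<theta> \<in> prob_simplex")
  case True
  have "Mn n f \<theta> = (\<Sum>m\<in>count_vectors n. \<Sum>x\<in>count_class m. f x * (\<Prod>z\<leftarrow>x. \<theta> z))"
    unfolding Mn_def
  proof (rule sum.cong[OF refl])
    fix m :: "'a \<Rightarrow> nat"
    have "(\<Sum>x\<in>count_class m. f x * (\<Prod>z\<leftarrow>x. \<theta> z)) = (\<Sum>x\<in>count_class m. f x * (\<Prod>z\<in>UNIV. \<theta> z ^ m z))"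
      by (rule sum.cong) (auto simp: count_class_eq prod_list_map_count)
    then show "1 / real (card (count_class m)) * sum f (count_class m) * bernstein_basis m \<theta> =
         (\<Sum>x\<in>count_class m. f x * (\<Prod>z\<leftarrow>x. \<theta> z))"
      using True count_class_nonempty[of m] by (simp add: bernstein_basis_def flip: sum_distrib_right)
  qed
  also have "\<dots> = (\<Sum>m\<in>count_vectors n. \<Sum>x\<in>{x \<in> seqs n. count_list x = m}. f x * (\<Prod>z\<leftarrow>x. \<theta> z))"
    by (intro sum.cong) (auto simp: count_class_eq seqs_def)
  also have "\<dots> = (\<Sum>x\<in>seqs n. f x * (\<Prod>z\<leftarrow>x. \<theta> z))"
    by (rule sum.group) (simp_all add: count_list_image_seqs)
  finally show ?thesis using True by simp
next
  case False
  then show ?thesis by (simp add: Mn_def bernstein_basis_def)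
qed

lemma Mn_zero: "Mn n (\<lambda>_. 0) = (\<lambda>_. 0)"
  by (simp add: Mn_def)

lemma Mn_add: "Mn n (\<lambda>x. f x + g x) = (\<lambda>\<theta>. Mn n f \<theta> + Mn n g \<theta>)"
  by (auto simp: Mn_eq fun_eq_iff distrib_right sum.distrib)

lemma Mn_scale: "Mn n (\<lambda>x. c * f x) = (\<lambda>\<theta>. c * Mn n f \<theta>)"
  by (auto simp: Mn_eq fun_eq_iff sum_distrib_left mult.assoc)

lemma Mn_diff: "Mn n (\<lambda>x. f x - g x) = (\<lambda>\<theta>. Mn n f \<theta> - Mn n g \<theta>)"
  by (auto simp: Mn_eq fun_eq_iff left_diff_distrib sum_subtractf)

lemma prod_list_permute:
  assumes "\<pi> permutes {..<length x}"
  shows "(\<Prod>z\<leftarrow>permute_list \<pi> x. \<theta> z) = (\<Prod>z\<leftarrow>x. \<theta> z :: real)"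
proof -
  have "mset (map \<theta> (permute_list \<pi> x)) = mset (map \<theta> x)"
    using assms by simp
  then show ?thesis by (metis prod_mset_prod_list)
qed

lemma permute_list_inv:
  assumes "\<pi> permutes {..<length x}"
  shows "permute_list \<pi> (permute_list (inv \<pi>) x) = x" "permute_list (inv \<pi>) (permute_list \<pi> x) = x"
  using assms permute_list_compose[of \<pi> x "inv \<pi>"] permute_list_compose[of "inv \<pi>" x \<pi>]
  by (simp_all add: permutes_inv permutes_inv_o)

text \<open>Stated for any closed set \<open>S\<close> of sequences, since it reindexes both the sum
  over all sequences and the sum over one count class.\<close>

lemma bij_betw_permute_list:
  assumes "\<pi> permutes {..<n}" "\<And>x. x \<in> S \<Longrightarrow> length x = n"
    "\<And>x \<sigma>. x \<in> S \<Longrightarrow> \<sigma> permutes {..<n} \<Longrightarrow> permute_list \<sigma> x \<in> S"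
  shows "bij_betw (permute_list \<pi>) S S"
  by (rule bij_betwI[where g = "permute_list (inv \<pi>)"])
    (use assms in \<open>auto simp: permute_list_inv permutes_inv\<close>)

lemma Mn_permute:
  assumes "\<pi> permutes {..<n}"
  shows "Mn n (f \<circ> permute_list \<pi>) = Mn n f"
proof -
  have "(\<Sum>x\<in>seqs n. f (permute_list \<pi> x) * (\<Prod>z\<leftarrow>x. \<theta> z)) = (\<Sum>x\<in>seqs n. f x * (\<Prod>z\<leftarrow>x. \<theta> z))" for \<theta>
    by (subst (2) sum.reindex_bij_betw[OF bij_betw_permute_list[OF assms], symmetric])
      (use assms in \<open>auto simp: seqs_def prod_list_permute\<close>)
  then show ?thesis by (simp add: fun_eq_iff Mn_eq)
qed

text \<open>A sequence of length \<open>n + k\<close> splits uniquely into a prefix and a tail, and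
  its weight is the product of their weights.\<close>

lemma sum_seqs_extend:
  "(\<Sum>x\<in>seqs (n + k). f (take n x) * (\<Prod>z\<leftarrow>x. \<theta> z)) =
   (\<Sum>x\<in>seqs n. f x * (\<Prod>z\<leftarrow>x. \<theta> z)) * (\<Sum>x\<in>seqs k. (\<Prod>z\<leftarrow>x. \<theta> z))" for \<theta> :: "'x::finite \<Rightarrow> real"
proof -
  have "bij_betw (\<lambda>(x, y). x @ y) (seqs n \<times> seqs k) (seqs (n + k) :: 'x list set)"
    by (rule bij_betwI[where g = "\<lambda>x. (take n x, drop n x)"]) (auto simp: seqs_def)
  then have "(\<Sum>x\<in>seqs (n + k). f (take n x) * (\<Prod>z\<leftarrow>x. \<theta> z)) =
    (\<Sum>(x, y)\<in>seqs n \<times> seqs k. f x * (\<Prod>z\<leftarrow>x. \<theta> z) * (\<Prod>z\<leftarrow>y. \<theta> z))"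
    by (subst sum.reindex_bij_betw[symmetric]) (auto simp: seqs_def intro!: sum.cong)
  then show ?thesis
    by (simp add: sum_product sum.cartesian_product)
qed

lemma sum_seqs_prod_list: "(\<Sum>x\<in>seqs k. (\<Prod>z\<leftarrow>x. \<theta> z)) = (\<Sum>z\<in>UNIV. \<theta> z) ^ k" for \<theta> :: "'x::finite \<Rightarrow> real"
proof (induction k)
  case 0
  then show ?case by (simp add: seqs_def)
next
  case (Suc k)
  have "bij_betw (\<lambda>z. [z]) UNIV (seqs 1 :: 'x list set)"
    by (rule bij_betwI[where g = hd]) (auto simp: seqs_def length_Suc_conv)
  then have "(\<Sum>x\<in>seqs 1. (\<Prod>z\<leftarrow>x. \<theta> z)) = (\<Sum>z\<in>UNIV. \<theta> z)"
    by (subst sum.reindex_bij_betw[symmetric]) auto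
  then show ?case
    using sum_seqs_extend[where f = "\<lambda>_. 1" and n = k and k = 1 and \<theta> = \<theta>] Suc by simp
qed

text \<open>The additional draws contribute the factor
  \<open>(\<Sum>z\<in>UNIV. \<theta> z) ^ k\<close>, which is 1 on the simplex.\<close>

lemma Mn_extend:
  assumes "n1 \<le> n2"
  shows "Mn n2 (extend_gamble n1 n2 f) = Mn n1 f"
proof -
  obtain k where k: "n2 = n1 + k" using assms le_Suc_ex by blast
  show ?thesis
    using sum_seqs_extend[where f = f and n = n1 and k = k]
    by (auto simp: fun_eq_iff Mn_eq extend_gamble_def k sum_seqs_prod_list prob_simplex_def
        cong: sum.cong)
qed

section \<open>Uniqueness of Bernstein expansions\<close>

lemma radix_expansion_inj:
  fixes a b :: "nat \<Rightarrow> nat"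
  assumes "\<forall>i<N. a i < B" "\<forall>i<N. b i < B" "(\<Sum>i<N. a i * B ^ i) = (\<Sum>i<N. b i * B ^ i)"
  shows "\<forall>i<N. a i = b i"
  using assms
proof (induction N arbitrary: a b)
  case (Suc N)
  have split: "(\<Sum>i<Suc N. c i * B ^ i) = c 0 + B * (\<Sum>i<N. c (Suc i) * B ^ i)" for c :: "nat \<Rightarrow> nat"
    unfolding sum.lessThan_Suc_shift by (simp add: sum_distrib_left algebra_simps)
  have eq: "a 0 + B * (\<Sum>i<N. a (Suc i) * B ^ i) = b 0 + B * (\<Sum>i<N. b (Suc i) * B ^ i)"
    using Suc.prems(3) unfolding split .
  have "a 0 < B" "b 0 < B" using Suc.prems by auto
  \<comment> \<open>Reduction modulo \<open>B\<close> isolates the lowest digit; cancelling it and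
    dividing by \<open>B\<close> leaves the shifted digits to the induction hypothesis.\<close>
  with arg_cong[OF eq, of "\<lambda>t. t mod B"] have 0: "a 0 = b 0" by simp
  with eq \<open>a 0 < B\<close> have "(\<Sum>i<N. a (Suc i) * B ^ i) = (\<Sum>i<N. b (Suc i) * B ^ i)" by auto
  then have "\<forall>i<N. a (Suc i) = b (Suc i)"
    using Suc.prems by (intro Suc.IH) auto
  with 0 show ?case using less_Suc_eq_0_disj by auto
qed simp

text \<open>The categories are enumerated and receive successive powers of \<open>Suc n\<close> as
  weights. Counts of total \<open>n\<close> are then digits in base \<open>Suc n\<close>, and the
  weighted sum determines them.\<close>

lemma separating_weights:
  obtains w :: "'x::finite \<Rightarrow> nat" where "inj_on (\<lambda>m. \<Sum>z\<in>UNIV. w z * m z) (count_vectors n)"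
proof -
  let ?k = "card (UNIV :: 'x set)"
  obtain e :: "nat \<Rightarrow> 'x" where e: "bij_betw e {..<?k} UNIV"
    using ex_bij_betw_nat_finite[of "UNIV :: 'x set"] by (auto simp: atLeast0LessThan)
  define w where "w z = Suc n ^ inv_into {..<?k} e z" for z
  have w: "(\<Sum>z\<in>UNIV. w z * m z) = (\<Sum>i<?k. m (e i) * Suc n ^ i)" for m
    using e by (subst sum.reindex_bij_betw[OF e, symmetric])
      (auto simp: w_def bij_betw_def mult.commute intro!: sum.cong)
  have bd: "m z < Suc n" if "m \<in> count_vectors n" for m :: "'x \<Rightarrow> nat" and z
    using that member_le_sum[of z UNIV m] by (auto simp: count_vectors_def)
  show ?thesis
  proof (rule that[of w], rule inj_onI)
    fix m m' :: "'x \<Rightarrow> nat"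
    assume m: "m \<in> count_vectors n" "m' \<in> count_vectors n"
      and eq: "(\<Sum>z\<in>UNIV. w z * m z) = (\<Sum>z\<in>UNIV. w z * m' z)"
    have "\<forall>i<?k. m (e i) = m' (e i)"
      using m bd eq unfolding w by (intro radix_expansion_inj[of _ _ "Suc n"]) auto
    moreover have "z \<in> e ` {..<?k}" for z using e by (auto simp: bij_betw_def)
    ultimately show "m = m'" by (metis ext imageE lessThan_iff)
  qed
qed

text \<open>
  Homogeneity extends the hypothesis to all positive points; substituting \<open>t ^ w z\<close> for
  \<open>\<theta> z\<close> with separating weights \<open>w\<close> (Kronecker) leaves a polynomial in one variable with
  the same coefficients.
\<close>

lemma homogeneous_coeffs_zero:
  fixes c :: "('x::finite \<Rightarrow> nat) \<Rightarrow> real"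
  assumes zero: "\<And>\<theta>. \<theta> \<in> prob_simplex \<Longrightarrow> (\<Sum>m\<in>count_vectors n. c m * (\<Prod>z\<in>UNIV. \<theta> z ^ m z)) = 0"
    and m0: "m0 \<in> count_vectors n"
  shows "c m0 = 0"
proof -
  have pos: "(\<Sum>m\<in>count_vectors n. c m * (\<Prod>z\<in>UNIV. \<theta> z ^ m z)) = 0"
    if "\<And>z. \<theta> z > 0" for \<theta> :: "'x \<Rightarrow> real"
  proof -
    define s where "s = (\<Sum>z\<in>UNIV. \<theta> z)"
    have s: "s > 0" using that by (auto simp: s_def intro!: sum_pos)
    have "(\<lambda>z. \<theta> z / s) \<in> prob_simplex"
      using s that by (auto simp: prob_simplex_def less_imp_le simp flip: sum_divide_distrib)
        (simp add: s_def)
    note zero[OF this]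
    moreover have "(\<Prod>z\<in>UNIV. (\<theta> z / s) ^ m z) = (\<Prod>z\<in>UNIV. \<theta> z ^ m z) / s ^ n"
      if "m \<in> count_vectors n" for m
      using that by (simp add: power_divide prod_dividef count_vectors_def flip: power_sum)
    ultimately have "(\<Sum>m\<in>count_vectors n. c m * (\<Prod>z\<in>UNIV. \<theta> z ^ m z)) / s ^ n = 0"
      by (simp add: sum_divide_distrib)
    then show ?thesis using s by simp
  qed
  obtain w :: "'x \<Rightarrow> nat" where inj: "inj_on (\<lambda>m. \<Sum>z\<in>UNIV. w z * m z) (count_vectors n)"
    by (rule separating_weights)
  define K where "K m = (\<Sum>z\<in>UNIV. w z * m z)" for m
  define N where "N = Max (K ` count_vectors n)"
  define C where "C i = (\<Sum>m\<in>{m \<in> count_vectors n. K m = i}. c m)" for i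
  have K: "K ` count_vectors n \<subseteq> {..N}" by (auto simp: N_def)
  have "(\<Sum>i\<le>N. C i * t ^ i) = 0" if "t > 0" for t :: real
  proof -
    have "(\<Sum>i\<le>N. C i * t ^ i) = (\<Sum>i\<le>N. \<Sum>m\<in>{m \<in> count_vectors n. K m = i}. c m * t ^ K m)"
      by (auto simp: C_def sum_distrib_right intro!: sum.cong)
    also have "\<dots> = (\<Sum>m\<in>count_vectors n. c m * t ^ K m)"
      by (rule sum.group) (simp_all add: K)
    also have "\<dots> = (\<Sum>m\<in>count_vectors n. c m * (\<Prod>z\<in>UNIV. (t ^ w z) ^ m z))"
      by (simp add: K_def power_sum power_mult)
    also have "\<dots> = 0" using that by (intro pos) simp
    finally show ?thesis .
  qed
  \<comment> \<open>Only positive \<open>t\<close> are covered, but infinitely many roots already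
    force every coefficient \<open>C i\<close> to be 0.\<close>
  then have "{0<..} \<subseteq> {t::real. (\<Sum>i\<le>N. C i * t ^ i) = 0}" by auto
  moreover have "infinite {0::real<..}" by (rule infinite_Ioi)
  ultimately have "infinite {t::real. (\<Sum>i\<le>N. C i * t ^ i) = 0}" by (metis finite_subset)
  then have "C (K m0) = 0"
    using K m0 by (auto simp: polyfun_finite_roots)
  moreover have "{m \<in> count_vectors n. K m = K m0} = {m0}"
    using inj m0 by (auto simp: inj_on_def K_def)
  ultimately show ?thesis by (simp add: C_def)
qed

text \<open>The difference of the two expansions is a homogeneous form vanishing on the simplex,
  with coefficients scaled by nonzero class sizes. Outside \<open>count_vectors n\<close> both
  functions take the default value 0.\<close>

lemma bernstein_expansion_unique:
  fixes b b' :: "('x::finite \<Rightarrow> nat) \<Rightarrow> real"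
  assumes b: "b \<in> gambles (count_vectors n)" "b' \<in> gambles (count_vectors n)"
    and eq: "(\<lambda>\<theta>. \<Sum>m\<in>count_vectors n. b m * bernstein_basis m \<theta>) =
      (\<lambda>\<theta>. \<Sum>m\<in>count_vectors n. b' m * bernstein_basis m \<theta>)"
  shows "b = b'"
proof
  fix m0 :: "'x \<Rightarrow> nat"
  show "b m0 = b' m0"
  proof (cases "m0 \<in> count_vectors n")
    case True
    have "(b m0 - b' m0) * real (card (count_class m0)) = 0"
    proof (rule homogeneous_coeffs_zero[OF _ True])
      fix \<theta> :: "'x \<Rightarrow> real"
      assume "\<theta> \<in> prob_simplex"
      with fun_cong[OF eq, of \<theta>]
      show "(\<Sum>m\<in>count_vectors n. (b m - b' m) * real (card (count_class m)) * (\<Prod>z\<in>UNIV. \<theta> z ^ m z)) = 0"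
        by (simp add: bernstein_basis_def left_diff_distrib sum_subtractf mult.assoc)
    qed
    then show ?thesis using count_class_nonempty[of m0] by simp
  next
    case False
    then show ?thesis using b by (simp add: gambles_count_vectors)
  qed
qed

text \<open>Gives access to the definite description in \<open>bernstein_coeffs\<close>: from here
  on, Bernstein coefficients are handled as class means of gambles.\<close>

lemma bernstein_coeffs_Mn:
  assumes "f \<in> gambles (seqs n)"
  shows "bernstein_coeffs n (Mn n f) = class_mean f"
  unfolding bernstein_coeffs_def
proof (rule the_equality)
  show "class_mean f \<in> gambles (count_vectors n) \<and>
    Mn n f = (\<lambda>\<theta>. \<Sum>m\<in>count_vectors n. class_mean f m * bernstein_basis m \<theta>)"
    using class_mean_gamble[OF assms] by (simp add: Mn_class_mean)
next
  fix b
  assume "b \<in> gambles (count_vectors n) \<and> Mn n f = (\<lambda>\<theta>. \<Sum>m\<in>count_vectors n. b m * bernstein_basis m \<theta>)"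
  then show "b = class_mean f"
    using class_mean_gamble[OF assms] by (intro bernstein_expansion_unique[of _ n]) (auto simp: Mn_class_mean)
qed

section \<open>Polynomial functions on the simplex\<close>

lemma extend_gamble_gamble: "extend_gamble n1 n2 f \<in> gambles (seqs n2 :: 'x::finite list set)"
  unfolding gambles_seqs by (simp add: extend_gamble_def seqs_def)

lemma extend_gamble_append:
  "length x = n1 \<Longrightarrow> n1 \<le> n2 \<Longrightarrow> extend_gamble n1 n2 f (x @ replicate (n2 - n1) z) = f x"
  by (simp add: extend_gamble_def seqs_def)

text \<open>Padding a sequence to length \<open>n2\<close> recovers the original value from the
  extension.\<close>

lemma extend_gamble_eqD:
  fixes f g :: "'x::finite list \<Rightarrow> real"
  assumes "n1 \<le> n2" "f \<in> gambles (seqs n1)" "g \<in> gambles (seqs n1)"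
    and eq: "extend_gamble n1 n2 f = extend_gamble n1 n2 g"
  shows "f = g"
proof
  fix x
  show "f x = g x"
  proof (cases "length x = n1")
    case True
    then show ?thesis
      \<comment> \<open>Here \<open>undefined\<close> is just some category; its choice is
        immaterial, as the extension ignores the padding.\<close>
      using fun_cong[OF eq, of "x @ replicate (n2 - n1) undefined"] assms(1)
      by (simp add: extend_gamble_append)
  qed (use assms in \<open>simp add: gambles_seqs\<close>)
qed

lemma extend_gamble_pos:
  assumes "n1 \<le> n2" "f \<in> gambles (seqs n1)" "f > (\<lambda>_. 0)"
  shows "extend_gamble n1 n2 f > (\<lambda>_ :: 'x::finite list. 0)"
proof -
  have "extend_gamble n1 n2 f \<noteq> (\<lambda>_. 0)"
  proof
    assume "extend_gamble n1 n2 f = (\<lambda>_. 0)"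
    also have "\<dots> = extend_gamble n1 n2 (\<lambda>_. 0)" by (simp add: extend_gamble_def)
    finally have "f = (\<lambda>_. 0)"
      using assms(1,2) by (rule extend_gamble_eqD[rotated -1]) (simp add: gambles_seqs)
    then show False using assms(3) by simp
  qed
  then show ?thesis
    using assms(3) by (auto simp: less_le le_fun_def extend_gamble_def)
qed

lemma Mn_sum:
  assumes "finite I"
  shows "Mn n (\<lambda>x. \<Sum>i\<in>I. c i * f i x) = (\<lambda>\<theta>. \<Sum>i\<in>I. c i * Mn n (f i) \<theta>)"
  using assms by (induction I) (simp_all add: Mn_zero Mn_add Mn_scale)

lemma Mn_indicator:
  assumes "\<theta> \<in> prob_simplex"
  shows "Mn (length x) (\<lambda>y. if y = x then 1 else 0) \<theta> = (\<Prod>z\<leftarrow>x. \<theta> z)"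
proof -
  have "x \<in> seqs (length x)" by (simp add: seqs_def)
  moreover have "(\<Sum>y\<in>seqs (length x). (if y = x then 1 else 0) * (\<Prod>z\<leftarrow>y. \<theta> z)) =
      (\<Sum>y\<in>seqs (length x). if y = x then \<Prod>z\<leftarrow>y. \<theta> z else 0)"
    by (rule sum.cong) auto
  ultimately show ?thesis using assms by (simp add: Mn_eq)
qed

text \<open>A monomial is the probability of any fixed sequence with the prescribed counts, hence
  \<open>Mn\<close> of an indicator. Extending the indicators to the common length \<open>n\<close>
  replaces explicit degree elevation.\<close>

lemma poly_fun_eq_Mn:
  fixes P :: "'x::finite mpoly"
  assumes "total_degree P \<le> n"
  shows "\<exists>f\<in>gambles (seqs n). poly_fun P = Mn n f"
proof -
  have "\<exists>y. count_list y = Poly_Mapping.lookup \<alpha>" for \<alpha> :: "'x \<Rightarrow>\<^sub>0 nat"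
    using count_class_nonempty[of "Poly_Mapping.lookup \<alpha>"] by (auto simp: count_class_eq)
  then obtain x where x: "\<And>\<alpha> :: 'x \<Rightarrow>\<^sub>0 nat. count_list (x \<alpha>) = Poly_Mapping.lookup \<alpha>"
    by metis
  have len: "length (x \<alpha>) \<le> n" if "\<alpha> \<in> Poly_Mapping.keys P" for \<alpha>
  proof -
    have "(\<Sum>z\<in>UNIV. Poly_Mapping.lookup \<alpha> z) \<le> total_degree P"
      unfolding total_degree_def using that by (intro Max_ge) auto
    then show ?thesis using assms by (simp flip: x add: sum_count_list)
  qed
  define g where "g \<alpha> = extend_gamble (length (x \<alpha>)) n (\<lambda>y. if y = x \<alpha> then 1 else 0)" for \<alpha>
  define f where "f y = (\<Sum>\<alpha>\<in>Poly_Mapping.keys P. Poly_Mapping.lookup P \<alpha> * g \<alpha> y)" for y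
  have f: "f \<in> gambles (seqs n)"
    unfolding gambles_seqs by (auto simp: f_def g_def extend_gamble_def seqs_def intro!: sum.neutral)
  have "poly_fun P \<theta> = Mn n f \<theta>" for \<theta>
  proof (cases "\<theta> \<in> prob_simplex")
    case True
    have "Mn n (g \<alpha>) \<theta> = (\<Prod>z\<in>UNIV. \<theta> z ^ Poly_Mapping.lookup \<alpha> z)"
      if "\<alpha> \<in> Poly_Mapping.keys P" for \<alpha>
      using True len[OF that] unfolding g_def
      by (simp add: Mn_extend Mn_indicator prod_list_map_count flip: x)
    then show ?thesis
      unfolding f_def using True by (simp add: poly_fun_def Mn_sum)
  qed (simp add: poly_fun_def Mn_eq)
  with f show ?thesis by blast
qed

text \<open>Conversely, the Bernstein form is itself a homogeneous polynomial of degree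
  \<open>n\<close>, or the zero polynomial.\<close>

lemma Mn_eq_poly_fun:
  fixes f :: "'x::finite list \<Rightarrow> real"
  shows "\<exists>P. poly_fun P = Mn n f \<and> total_degree P \<le> n"
proof -
  let ?V = "{\<alpha> :: 'x \<Rightarrow>\<^sub>0 nat. Poly_Mapping.lookup \<alpha> \<in> count_vectors n}"
  define c where "c m = (if m \<in> count_vectors n then class_mean f m * real (card (count_class m)) else 0)" for m
  define P where "P = Abs_poly_mapping (\<lambda>\<alpha>. c (Poly_Mapping.lookup \<alpha>))"
  \<comment> \<open>Over finitely many categories every exponent function has finite support, so
    \<open>lookup\<close> matches \<open>?V\<close> with the count vectors. Finiteness of
    \<open>?V\<close> is what makes \<open>P\<close> a legitimate finitely supported map.\<close>
  have bij: "bij_betw Poly_Mapping.lookup ?V (count_vectors n)"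
    by (rule bij_betwI[where g = Abs_poly_mapping])
      (auto simp: Abs_poly_mapping_inverse lookup_inverse)
  then have fin: "finite ?V" using bij_betw_finite finite_count_vectors by blast
  have "{\<alpha>. c (Poly_Mapping.lookup \<alpha>) \<noteq> 0} \<subseteq> ?V" by (auto simp: c_def)
  then have P: "Poly_Mapping.lookup P \<alpha> = c (Poly_Mapping.lookup \<alpha>)" for \<alpha>
    unfolding P_def using fin by (subst lookup_Abs_poly_mapping) (auto intro: finite_subset)
  then have keys: "Poly_Mapping.keys P \<subseteq> ?V"
    by (auto simp: in_keys_iff c_def split: if_splits)
  have "poly_fun P \<theta> = Mn n f \<theta>" for \<theta>
  proof (cases "\<theta> \<in> prob_simplex")
    case True
    have "poly_fun P \<theta> = (\<Sum>\<alpha>\<in>?V. Poly_Mapping.lookup P \<alpha> * (\<Prod>z\<in>UNIV. \<theta> z ^ Poly_Mapping.lookup \<alpha> z))"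
      using True keys fin unfolding poly_fun_def
      by (auto intro!: sum.mono_neutral_left simp: in_keys_iff)
    also have "\<dots> = (\<Sum>m\<in>count_vectors n. c m * (\<Prod>z\<in>UNIV. \<theta> z ^ m z))"
      by (simp add: P sum.reindex_bij_betw[OF bij, symmetric])
    also have "\<dots> = Mn n f \<theta>"
      using True by (auto simp: Mn_class_mean c_def bernstein_basis_def intro!: sum.cong)
    finally show ?thesis .
  qed (simp add: poly_fun_def Mn_eq)
  moreover have "total_degree P \<le> n"
    using keys by (auto simp: total_degree_def count_vectors_def)
  ultimately show ?thesis by blast
qed

lemma poly_deg_attained:
  assumes "p \<in> simplex_polys"
  shows "\<exists>P. poly_fun P = p \<and> total_degree P = poly_deg p"
proof -
  have "\<exists>d P. poly_fun P = p \<and> total_degree P = d"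
    using assms by (auto simp: simplex_polys_def)
  from LeastI_ex[OF this] show ?thesis by (simp add: poly_deg_def)
qed

lemma simplex_poly_eq_Mn:
  assumes "p \<in> simplex_polys" "poly_deg p \<le> n"
  shows "\<exists>f\<in>gambles (seqs n). p = Mn n f"
proof -
  obtain P where "poly_fun P = p" "total_degree P = poly_deg p"
    using poly_deg_attained[OF assms(1)] by blast
  then show ?thesis using poly_fun_eq_Mn[of P n] assms(2) by simp
qed

lemma Mn_simplex_poly: "Mn n f \<in> simplex_polys"
proof -
  obtain P where "poly_fun P = Mn n f" using Mn_eq_poly_fun by blast
  then show ?thesis unfolding simplex_polys_def by (intro range_eqI[of _ _ P]) simp
qed

lemma poly_deg_Mn_le: "poly_deg (Mn n f) \<le> n"
proof -
  obtain P where P: "poly_fun P = Mn n f" "total_degree P \<le> n"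
    using Mn_eq_poly_fun by blast
  then have "poly_deg (Mn n f) \<le> total_degree P"
    unfolding poly_deg_def by (intro Least_le) blast
  with P show ?thesis by simp
qed

lemma simplex_polys_eq_Mn:
  assumes "p \<in> simplex_polys"
  shows "\<exists>n\<ge>1. \<exists>f\<in>gambles (seqs n). p = Mn n f"
  \<comment> \<open>The successor ensures a level of at least 1 even for constants, as families are
    indexed from 1.\<close>
  using simplex_poly_eq_Mn[OF assms, of "Suc (poly_deg p)"]
  by (intro exI[of _ "Suc (poly_deg p)"]) simp

lemma simplex_polys_scale:
  assumes "p \<in> simplex_polys"
  shows "(\<lambda>\<theta>. c * p \<theta>) \<in> simplex_polys"
proof -
  obtain n f where "p = Mn n f" using simplex_polys_eq_Mn[OF assms] by blast
  then show ?thesis using Mn_simplex_poly[of n "\<lambda>x. c * f x"] by (simp add: Mn_scale)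
qed

text \<open>Polynomials coming from gambles of different lengths are added after extending both
  gambles to the larger length.\<close>

lemma Mn_add_levels:
  "(\<lambda>\<theta>. Mn j f \<theta> + Mn k g \<theta>) =
    Mn (max j k) (\<lambda>x. extend_gamble j (max j k) f x + extend_gamble k (max j k) g x)"
  by (simp add: Mn_add Mn_extend)

lemma simplex_polys_add:
  assumes "p \<in> simplex_polys" "q \<in> simplex_polys"
  shows "(\<lambda>\<theta>. p \<theta> + q \<theta>) \<in> simplex_polys"
proof -
  obtain j f k g where "p = Mn j f" "q = Mn k g"
    using simplex_polys_eq_Mn[OF assms(1)] simplex_polys_eq_Mn[OF assms(2)] by blast
  then show ?thesis by (simp add: Mn_add_levels Mn_simplex_poly)
qed

section \<open>The kernel of the multinomial map\<close>

text \<open>As \<pi> runs through the permutations, so does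
  \<open>\<sigma> \<circ> \<pi>\<close>.\<close>

lemma sum_permute_list_invariant:
  assumes "\<sigma> permutes {..<length x}"
  shows "(\<Sum>\<pi> | \<pi> permutes {..<length x}. f (permute_list \<pi> (permute_list \<sigma> x))) =
    (\<Sum>\<pi> | \<pi> permutes {..<length x}. f (permute_list \<pi> x) :: real)"
proof -
  have bij: "bij_betw ((\<circ>) \<sigma>) {\<pi>. \<pi> permutes {..<length x}} {\<pi>. \<pi> permutes {..<length x}}"
    by (rule bij_betwI[where g = "(\<circ>) (inv \<sigma>)"])
      (use assms in \<open>auto simp: permutes_compose permutes_inv permutes_inv_o o_assoc\<close>)
  have "f (permute_list \<pi> (permute_list \<sigma> x)) = f (permute_list (\<sigma> \<circ> \<pi>) x)"
    if "\<pi> permutes {..<length x}" for \<pi>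
    using that by (simp add: permute_list_compose)
  then show ?thesis
    by (simp add: sum.reindex_bij_betw[OF bij, of "\<lambda>\<pi>. f (permute_list \<pi> x)", symmetric])
qed

text \<open>
  The sum over all permutations of \<open>x\<close> is constant on count classes, so it suffices that
  its total over a class vanishes.
\<close>

lemma sum_permutations_eq_0:
  assumes f: "f \<in> gambles (seqs n :: 'x::finite list set)" and zero: "class_mean f = (\<lambda>_. 0)"
    and x: "length x = n"
  shows "(\<Sum>\<pi> | \<pi> permutes {..<n}. f (permute_list \<pi> x)) = 0"
proof -
  let ?C = "count_class (count_list x)"
  let ?F = "\<lambda>y. \<Sum>\<pi> | \<pi> permutes {..<n}. f (permute_list \<pi> y)"
  have C: "y \<in> ?C \<longleftrightarrow> mset y = mset x" for y
    by (auto simp: count_class_eq fun_eq_iff multiset_eq_iff count_mset)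
  have len: "length y = n" if "y \<in> ?C" for y
    using that x by (metis C size_mset)
  have "?F y = ?F x" if "y \<in> ?C" for y
  proof -
    have "mset y = mset x" using that unfolding C .
    then obtain \<sigma> where "\<sigma> permutes {..<length x}" "permute_list \<sigma> x = y"
      by (rule mset_eq_permutation)
    then show ?thesis using sum_permute_list_invariant[of \<sigma> x f] x by simp
  qed
  then have "real (card ?C) * ?F x = (\<Sum>y\<in>?C. ?F y)" by simp
  \<comment> \<open>After exchanging the sums, each permutation maps the class onto itself, so every
    inner sum is the class total, which is 0 by hypothesis.\<close>
  also have "\<dots> = (\<Sum>\<pi> | \<pi> permutes {..<n}. \<Sum>y\<in>?C. f (permute_list \<pi> y))"
    by (rule sum.swap)
  also have "\<dots> = (\<Sum>\<pi> | \<pi> permutes {..<n}. \<Sum>y\<in>?C. f y)"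
    by (intro sum.cong sum.reindex_bij_betw bij_betw_permute_list refl)
      (auto simp: len C dest: len[unfolded C])
  also have "\<dots> = 0"
    using fun_cong[OF zero, of "count_list x"] count_class_nonempty[of "count_list x"]
    by (simp add: class_mean_def)
  finally show ?thesis using count_class_nonempty[of "count_list x"] by simp
qed

lemma class_mean_zero:
  assumes "f \<in> gambles (seqs n)" "Mn n f = (\<lambda>_. 0)"
  shows "class_mean f = (\<lambda>_. 0)"
proof -
  have "(\<lambda>_. 0) \<in> gambles (seqs n :: 'a list set)" by (simp add: gambles_seqs)
  from bernstein_coeffs_Mn[OF this] have "bernstein_coeffs n (\<lambda>_. 0) = class_mean (\<lambda>_ :: 'a list. 0)"
    by (simp add: Mn_zero)
  moreover have "class_mean (\<lambda>_ :: 'a list. 0) = (\<lambda>_. 0)" by (simp add: class_mean_def fun_eq_iff)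
  ultimately show ?thesis
    using bernstein_coeffs_Mn[OF assms(1)] assms(2) by simp
qed

text \<open>By \<open>sum_permutations_eq_0\<close>, the average of \<open>f\<close> over all
  rearrangements vanishes, so \<open>f\<close> is the average of the differences
  \<open>f - f \<circ> permute_list \<pi>\<close>. With the averaging factor absorbed into
  \<open>g\<close>, exchangeability adds these differences to \<open>h\<close> one at a
  time.\<close>

lemma exchangeable_add_null:
  fixes R :: "('x::finite list \<Rightarrow> real) set"
  assumes ex: "exchangeable n R" and h: "h \<in> R"
    and f: "f \<in> gambles (seqs n)" and null: "Mn n f = (\<lambda>_. 0)"
  shows "(\<lambda>x. h x + f x) \<in> R"
proof -
  let ?P = "{\<pi>. \<pi> permutes {..<n}}"
  define g where "g x = f x / real (card ?P)" for x
  have g: "g \<in> gambles (seqs n)" using f by (simp add: gambles_seqs g_def)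
  have fin: "finite ?P" by (simp add: finite_permutations)
  have ne: "card ?P \<noteq> 0"
    by (metis card_permutations card_lessThan finite_lessThan fact_nonzero)
  have "(\<lambda>x. h x + (\<Sum>\<pi>\<in>S. g x - g (permute_list \<pi> x))) \<in> R" if "finite S" "S \<subseteq> ?P" for S
    using that
  proof (induction S)
    case (insert \<pi> S)
    then have "(\<lambda>x. h x + (\<Sum>\<pi>\<in>S. g x - g (permute_list \<pi> x))) \<in> R" "\<pi> permutes {..<n}"
      by simp_all
    then have "(\<lambda>x. (h x + (\<Sum>\<pi>\<in>S. g x - g (permute_list \<pi> x))) + (g x - (g \<circ> permute_list \<pi>) x)) \<in> R"
      by (intro ex[unfolded exchangeable_def, rule_format] g)
    then show ?case using insert.hyps by (simp add: algebra_simps)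
  qed (simp add: h)
  then have "(\<lambda>x. h x + (\<Sum>\<pi>\<in>?P. g x - g (permute_list \<pi> x))) \<in> R"
    using fin by blast
  moreover have "(\<Sum>\<pi>\<in>?P. g x - g (permute_list \<pi> x)) = f x" for x
  proof -
    have "(\<Sum>\<pi>\<in>?P. f (permute_list \<pi> x)) = 0"
    proof (cases "length x = n")
      case True
      then show ?thesis by (rule sum_permutations_eq_0[OF f class_mean_zero[OF f null]])
    qed (use f in \<open>simp add: gambles_seqs\<close>)
    then have "(\<Sum>\<pi>\<in>?P. g (permute_list \<pi> x)) = 0"
      by (simp add: g_def flip: sum_divide_distrib)
    then show ?thesis using ne by (simp add: sum_subtractf g_def)
  qed
  ultimately show ?thesis by simp
qed

section \<open>Bernstein coherence\<close>

lemma Mn_lift_class_mean: "Mn n (class_mean f \<circ> count_list) = Mn n f"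
  by (simp add: Mn_class_mean class_mean_lift)

text \<open>The polynomials that every Bernstein coherent set must contain; non-positivity is later
  expressed through their negatives.\<close>

definition bernstein_positive :: "(('x::finite \<Rightarrow> real) \<Rightarrow> real) set" where
  "bernstein_positive = {p \<in> simplex_polys. \<exists>r\<ge>poly_deg p. bernstein_coeffs r p > (\<lambda>_. 0)}"

lemma class_mean_pos:
  assumes "f > (\<lambda>_. 0)"
  shows "class_mean f > (\<lambda>_ :: 'x::finite \<Rightarrow> nat. 0)"
proof -
  have nonneg: "f y \<ge> 0" for y using assms by (auto simp: less_le le_fun_def)
  obtain x where "f x \<noteq> 0" using assms by (auto simp: less_le fun_eq_iff)
  with nonneg have x: "f x > 0" by (simp add: less_le)
  have "class_mean f (count_list x) > 0"
    unfolding class_mean_def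
  proof (intro mult_pos_pos)
    show "sum f (count_class (count_list x)) > 0"
      using x nonneg by (intro sum_pos2[of _ x]) (auto simp: count_class_eq finite_count_class[unfolded count_class_eq])
  qed (use count_class_nonempty in \<open>simp add: card_gt_0_iff\<close>)
  moreover have "class_mean f m \<ge> 0" for m
    using nonneg by (auto simp: class_mean_def intro!: divide_nonneg_nonneg sum_nonneg)
  ultimately show ?thesis
    by (fastforce simp: less_le le_fun_def fun_eq_iff)
qed

text \<open>Positive coefficients, lifted along \<open>count_list\<close>, form a positive gamble;
  conversely, class averaging preserves positivity. The right-hand side avoids degrees and the
  definite description.\<close>

lemma bernstein_positive_iff:
  "p \<in> bernstein_positive \<longleftrightarrow> (\<exists>r\<ge>1. \<exists>f\<in>gambles (seqs r). f > (\<lambda>_. 0) \<and> p = Mn r f)"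
proof
  assume "p \<in> bernstein_positive"
  then obtain r where p: "p \<in> simplex_polys" and r: "r \<ge> poly_deg p" "bernstein_coeffs r p > (\<lambda>_. 0)"
    by (auto simp: bernstein_positive_def)
  obtain g where g: "g \<in> gambles (seqs r)" "p = Mn r g"
    using simplex_poly_eq_Mn[OF p r(1)] by blast
  \<comment> \<open>The gamble \<open>g\<close> may take negative values; only its class means are
    known to be nonnegative, so it is replaced by its symmetrisation.\<close>
  define f where "f = class_mean g \<circ> count_list"
  have pos: "class_mean g > (\<lambda>_. 0)" using r g by (simp add: bernstein_coeffs_Mn)
  have "f \<noteq> (\<lambda>_. 0)"
  proof
    assume "f = (\<lambda>_. 0)"
    then have "class_mean f = (\<lambda>_. 0)" by (simp add: class_mean_def fun_eq_iff)
    with pos show False by (simp add: f_def class_mean_lift)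
  qed
  with pos have f: "f > (\<lambda>_. 0)" by (auto simp: f_def less_le le_fun_def)
  have fg: "f \<in> gambles (seqs r)" "p = Mn r f"
    using g by (simp_all add: f_def lift_gamble class_mean_gamble Mn_lift_class_mean)
  \<comment> \<open>The level \<open>r\<close> may be 0, hence the passage to
    \<open>Suc r\<close>.\<close>
  show "\<exists>r\<ge>1. \<exists>f\<in>gambles (seqs r). f > (\<lambda>_. 0) \<and> p = Mn r f"
    using fg f by (intro exI[of _ "Suc r"] conjI bexI[of _ "extend_gamble r (Suc r) f"])
      (simp_all add: extend_gamble_pos extend_gamble_gamble Mn_extend)
next
  assume "\<exists>r\<ge>1. \<exists>f\<in>gambles (seqs r). f > (\<lambda>_. 0) \<and> p = Mn r f"
  then obtain r f where "f \<in> gambles (seqs r)" "f > (\<lambda>_. 0)" "p = Mn r f" by blast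
  then show "p \<in> bernstein_positive"
    unfolding bernstein_positive_def using Mn_simplex_poly[of r f] poly_deg_Mn_le[of r f]
    by (auto simp: bernstein_coeffs_Mn class_mean_pos)
qed

text \<open>Nonpositive coefficients at some level either all vanish, so that \<open>p\<close> is 0,
  or become positive after a change of sign.\<close>

lemma bernstein_nonpositive_iff:
  assumes "p \<in> simplex_polys"
  shows "(\<exists>r\<ge>poly_deg p. bernstein_coeffs r p \<le> (\<lambda>_. 0)) \<longleftrightarrow>
    p = (\<lambda>_. 0) \<or> (\<lambda>\<theta>. - p \<theta>) \<in> bernstein_positive"
proof
  assume "\<exists>r\<ge>poly_deg p. bernstein_coeffs r p \<le> (\<lambda>_. 0)"
  then obtain r where r: "r \<ge> poly_deg p" "bernstein_coeffs r p \<le> (\<lambda>_. 0)" by blast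
  obtain g where g: "g \<in> gambles (seqs r)" "p = Mn r g"
    using simplex_poly_eq_Mn[OF assms r(1)] by blast
  have le: "class_mean g \<le> (\<lambda>_. 0)" using r g by (simp add: bernstein_coeffs_Mn)
  show "p = (\<lambda>_. 0) \<or> (\<lambda>\<theta>. - p \<theta>) \<in> bernstein_positive"
  proof (cases "class_mean g = (\<lambda>_. 0)")
    case True
    then have "p = (\<lambda>_. 0)" using g by (simp add: Mn_class_mean)
    then show ?thesis ..
  next
    case False
    \<comment> \<open>The negation is written as a multiple so that \<open>Mn_scale\<close>
      applies.\<close>
    let ?h = "\<lambda>x. - 1 * g x"
    have h: "?h \<in> gambles (seqs r)" "Mn r ?h = (\<lambda>\<theta>. - p \<theta>)"
      using g by (auto simp: gambles_seqs Mn_scale simp del: mult_minus1 mult_minus_left)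
    have "class_mean ?h = (\<lambda>m. - class_mean g m)"
      by (simp add: class_mean_def sum_negf fun_eq_iff)
    then have "class_mean ?h > (\<lambda>_. 0)"
      using le False by (auto simp: less_le le_fun_def fun_eq_iff)
    then have "Mn r ?h \<in> bernstein_positive"
      using h(1) Mn_simplex_poly poly_deg_Mn_le
      unfolding bernstein_positive_def by (metis (mono_tags, lifting) bernstein_coeffs_Mn mem_Collect_eq)
    then show ?thesis unfolding h(2) ..
  qed
next
  assume "p = (\<lambda>_. 0) \<or> (\<lambda>\<theta>. - p \<theta>) \<in> bernstein_positive"
  then obtain r f where f: "f \<in> gambles (seqs r)" "f \<ge> (\<lambda>_. 0)" "\<And>\<theta>. - p \<theta> = Mn r f \<theta>"
  proof
    assume "p = (\<lambda>_. 0)"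
    then show thesis by (intro that[of "\<lambda>_. 0" 0]) (simp_all add: gambles_seqs Mn_zero)
  next
    assume "(\<lambda>\<theta>. - p \<theta>) \<in> bernstein_positive"
    then obtain r f where "f \<in> gambles (seqs r)" "f > (\<lambda>_. 0)" "(\<lambda>\<theta>. - p \<theta>) = Mn r f"
      unfolding bernstein_positive_iff by blast
    then show thesis by (intro that[of f r]) (simp_all add: fun_eq_iff)
  qed
  let ?h = "\<lambda>x. - 1 * f x"
  have h: "?h \<in> gambles (seqs r)" using f(1) by (simp add: gambles_seqs)
  have p: "p = Mn r ?h" unfolding Mn_scale using f(3) by (simp add: fun_eq_iff flip: f(3))
  have "class_mean ?h m \<le> 0" for m
    using f(2) by (auto simp: class_mean_def le_fun_def sum_negf intro!: divide_nonneg_nonneg sum_nonneg)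
  then have "bernstein_coeffs r p \<le> (\<lambda>_. 0)"
    using bernstein_coeffs_Mn[OF h] p by (simp add: le_fun_def)
  moreover have "poly_deg p \<le> r" unfolding p by (rule poly_deg_Mn_le)
  ultimately show "\<exists>r\<ge>poly_deg p. bernstein_coeffs r p \<le> (\<lambda>_. 0)" by blast
qed

lemma bernstein_positive_scale:
  assumes "p \<in> bernstein_positive" "c > 0"
  shows "(\<lambda>\<theta>. c * p \<theta>) \<in> bernstein_positive"
proof -
  obtain r f where "r \<ge> 1" "f \<in> gambles (seqs r)" "f > (\<lambda>_. 0)" "p = Mn r f"
    using assms(1) unfolding bernstein_positive_iff by blast
  then show ?thesis
    unfolding bernstein_positive_iff using assms(2)
    by (intro exI[of _ r] conjI bexI[of _ "\<lambda>x. c * f x"])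
      (auto simp: gambles_seqs Mn_scale less_le le_fun_def fun_eq_iff)
qed

lemma add_fun_pos:
  fixes f g :: "'a \<Rightarrow> real"
  assumes "f > (\<lambda>_. 0)" "g > (\<lambda>_. 0)"
  shows "(\<lambda>x. f x + g x) > (\<lambda>_. 0)"
  using assms by (fastforce simp: less_le le_fun_def fun_eq_iff add_nonneg_eq_0_iff)

lemma bernstein_positive_add:
  assumes "p \<in> bernstein_positive" "q \<in> bernstein_positive"
  shows "(\<lambda>\<theta>. p \<theta> + q \<theta>) \<in> bernstein_positive"
proof -
  obtain j f where j: "j \<ge> 1" "f \<in> gambles (seqs j)" "f > (\<lambda>_. 0)" "p = Mn j f"
    using assms(1) unfolding bernstein_positive_iff by blast
  obtain k g where k: "g \<in> gambles (seqs k)" "g > (\<lambda>_. 0)" "q = Mn k g"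
    using assms(2) unfolding bernstein_positive_iff by blast
  let ?h = "\<lambda>x. extend_gamble j (max j k) f x + extend_gamble k (max j k) g x"
  have "?h \<in> gambles (seqs (max j k))"
    using extend_gamble_gamble[of j "max j k" f] extend_gamble_gamble[of k "max j k" g]
    by (simp add: gambles_seqs)
  moreover have "?h > (\<lambda>_. 0)"
    using j k by (intro add_fun_pos extend_gamble_pos) simp_all
  ultimately show ?thesis
    unfolding bernstein_positive_iff j(4) k(3) Mn_add_levels using j(1)
    by (intro exI[of _ "max j k"] conjI bexI[of _ ?h]) simp_all
qed

text \<open>By uniqueness of expansions the zero polynomial has only zero coefficients, whatever the
  level.\<close>

lemma zero_notin_bernstein_positive: "(\<lambda>_. 0) \<notin> bernstein_positive"
proof
  assume "(\<lambda>_. 0) \<in> (bernstein_positive :: (('x::finite \<Rightarrow> real) \<Rightarrow> real) set)"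
  then obtain r and f :: "'x list \<Rightarrow> real"
    where f: "f \<in> gambles (seqs r)" "f > (\<lambda>_. 0)" "Mn r f = (\<lambda>_. 0)"
    unfolding bernstein_positive_iff by metis
  then show False using class_mean_pos[OF f(2)] class_mean_zero[OF f(1,3)] by simp
qed

section \<open>Convex cones, positive hulls and Bernstein coherent supersets\<close>

definition convex_cone :: "('a \<Rightarrow> real) set \<Rightarrow> bool" where
  "convex_cone C \<longleftrightarrow> (\<forall>p\<in>C. \<forall>c>0. (\<lambda>\<theta>. c * p \<theta>) \<in> C) \<and> (\<forall>p\<in>C. \<forall>q\<in>C. (\<lambda>\<theta>. p \<theta> + q \<theta>) \<in> C)"

lemma convex_cone_add: "convex_cone C \<Longrightarrow> p \<in> C \<Longrightarrow> q \<in> C \<Longrightarrow> (\<lambda>\<theta>. p \<theta> + q \<theta>) \<in> C"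
  by (simp add: convex_cone_def)

lemma bernstein_coherent_iff:
  "bernstein_coherent H \<longleftrightarrow> H \<subseteq> simplex_polys \<and> (\<lambda>_. 0) \<notin> H \<and> bernstein_positive \<subseteq> H \<and> convex_cone H"
  by (auto simp: bernstein_coherent_def bernstein_positive_def convex_cone_def)

lemma posi_least:
  assumes C: "convex_cone C" and A: "A \<subseteq> C"
  shows "posi A \<subseteq> C"
proof -
  have "(\<lambda>\<theta>. \<Sum>k=1..n. c k * p k \<theta>) \<in> C" if "n \<ge> 1" "\<forall>k\<in>{1..n}. p k \<in> A \<and> c k > 0" for n :: nat and c p
    using that
  \<comment> \<open>The induction starts from a single summand, because a cone in the present sense
    may omit 0.\<close>
  proof (induction n rule: nat_induct_at_least)
    case base
    then show ?case using C A by (auto simp: convex_cone_def)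
  next
    case (Suc n)
    have "p (Suc n) \<in> C" "c (Suc n) > 0" using Suc.prems A by auto
    then have 1: "(\<lambda>\<theta>. c (Suc n) * p (Suc n) \<theta>) \<in> C"
      using C by (simp add: convex_cone_def)
    have 2: "(\<lambda>\<theta>. \<Sum>k=1..n. c k * p k \<theta>) \<in> C" using Suc by simp
    show ?case using C 1 2 unfolding convex_cone_def by simp
  qed
  then show ?thesis by (auto simp: posi_def)
qed

lemma subset_posi: "A \<subseteq> posi A"
proof
  fix p assume "p \<in> A"
  then show "p \<in> posi A"
    unfolding posi_def by (intro CollectI exI[of _ "1::nat"] exI[of _ "\<lambda>_. 1"] exI[of _ "\<lambda>_. p"]) auto
qed

lemma convex_cone_posi: "convex_cone (posi A)"
  unfolding convex_cone_def
proof (intro conjI ballI allI impI)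
  fix p and d :: real assume "p \<in> posi A" "d > 0"
  then obtain n c q where "p = (\<lambda>\<theta>. \<Sum>k=1..n. c k * q k \<theta>)" "n \<ge> (1::nat)" "\<forall>k\<in>{1..n}. q k \<in> A \<and> c k > 0"
    unfolding posi_def by blast
  with \<open>d > 0\<close> show "(\<lambda>\<theta>. d * p \<theta>) \<in> posi A"
    unfolding posi_def
    by (intro CollectI exI[of _ n] exI[of _ "\<lambda>k. d * c k"] exI[of _ q])
      (auto simp: sum_distrib_left mult.assoc)
next
  fix p q assume "p \<in> posi A" "q \<in> posi A"
  then obtain n c f m d g where p: "p = (\<lambda>\<theta>. \<Sum>k=1..n. c k * f k \<theta>)" "n \<ge> (1::nat)" "\<forall>k\<in>{1..n}. f k \<in> A \<and> c k > 0"
    and q: "q = (\<lambda>\<theta>. \<Sum>k=1..m. d k * g k \<theta>)" "m \<ge> (1::nat)" "\<forall>k\<in>{1..m}. g k \<in> A \<and> d k > 0"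
    unfolding posi_def by blast
  \<comment> \<open>The two combinations are concatenated: indices above \<open>n\<close> carry the
    second one, shifted by \<open>n\<close>.\<close>
  define e where "e k = (if k \<le> n then c k else d (k - n))" for k
  define h where "h k = (if k \<le> n then f k else g (k - n))" for k
  have "(\<Sum>k=1..n+m. e k * h k \<theta>) = p \<theta> + q \<theta>" for \<theta>
  proof -
    have "(\<Sum>k=1..n+m. e k * h k \<theta>) = (\<Sum>k=1..n. e k * h k \<theta>) + (\<Sum>k=n+1..n+m. e k * h k \<theta>)"
      by (rule sum.ub_add_nat) simp
    also have "(\<Sum>k=n+1..n+m. e k * h k \<theta>) = (\<Sum>k=1..m. e (k + n) * h (k + n) \<theta>)"
      using sum.shift_bounds_cl_nat_ivl[of "\<lambda>k. e k * h k \<theta>" 1 n m] by (simp add: add.commute)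
    finally show ?thesis by (simp add: p q e_def h_def)
  qed
  moreover have "\<forall>k\<in>{1..n+m}. h k \<in> A \<and> e k > 0"
  proof
    fix k assume "k \<in> {1..n+m}"
    then have "k \<in> {1..n} \<or> \<not> k \<le> n \<and> k - n \<in> {1..m}" by auto
    then show "h k \<in> A \<and> e k > 0"
      using p(3) q(3) by (auto simp: e_def h_def simp del: One_nat_def)
  qed
  ultimately show "(\<lambda>\<theta>. p \<theta> + q \<theta>) \<in> posi A"
    unfolding posi_def using p(2)
    by (intro CollectI exI[of _ "n + m"] exI[of _ e] exI[of _ h]) auto
qed

lemma convex_cone_simplex_polys: "convex_cone simplex_polys"
  by (simp add: convex_cone_def simplex_polys_scale simplex_polys_add)

lemma convex_cone_bernstein_positive: "convex_cone bernstein_positive"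
  by (simp add: convex_cone_def bernstein_positive_scale bernstein_positive_add)

lemma avoids_iff:
  assumes "A \<subseteq> simplex_polys"
  shows "avoids_bernstein_nonpositivity A \<longleftrightarrow>
    (\<forall>p\<in>posi A. p \<noteq> (\<lambda>_. 0) \<and> (\<lambda>\<theta>. - p \<theta>) \<notin> bernstein_positive)"
proof -
  have "posi A \<subseteq> simplex_polys" by (rule posi_least[OF convex_cone_simplex_polys assms])
  then show ?thesis
    unfolding avoids_bernstein_nonpositivity_def using bernstein_nonpositive_iff by blast
qed

text \<open>If \<open>p\<close> in the hull had nonpositive coefficients, then \<open>p\<close>
  would be 0 or \<open>- p\<close> would be in \<open>H\<close> too; either way 0 would be in
  \<open>H\<close>.\<close>

lemma bernstein_coherent_avoids:
  assumes H: "bernstein_coherent H" and A: "A \<subseteq> H"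
  shows "avoids_bernstein_nonpositivity A"
proof -
  have sub: "posi A \<subseteq> H" using posi_least[OF _ A] H by (simp add: bernstein_coherent_iff)
  have "p \<noteq> (\<lambda>_. 0) \<and> (\<lambda>\<theta>. - p \<theta>) \<notin> bernstein_positive" if "p \<in> H" for p
  proof (intro conjI notI)
    assume "(\<lambda>\<theta>. - p \<theta>) \<in> bernstein_positive"
    then have "(\<lambda>\<theta>. - p \<theta>) \<in> H"
      using H unfolding bernstein_coherent_iff by (elim conjE) (rule subsetD)
    with \<open>p \<in> H\<close> have "(\<lambda>\<theta>. p \<theta> + - p \<theta>) \<in> H"
      using H by (intro convex_cone_add) (simp_all add: bernstein_coherent_iff)
    then show False using H by (simp add: bernstein_coherent_iff)
  qed (use H that in \<open>auto simp: bernstein_coherent_iff\<close>)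
  moreover have "A \<subseteq> simplex_polys" using A H by (auto simp: bernstein_coherent_iff)
  ultimately show ?thesis using sub by (simp add: avoids_iff subset_iff)
qed

text \<open>\<open>C\<close> and \<open>D\<close> are listed beside their sum since neither has to
  contain 0.\<close>

lemma convex_cone_sum:
  assumes "convex_cone C" "convex_cone D"
  shows "convex_cone (C \<union> D \<union> {\<lambda>\<theta>. p \<theta> + q \<theta> | p q. p \<in> C \<and> q \<in> D})" (is "convex_cone ?S")
proof -
  have CD: "(\<lambda>\<theta>. p \<theta> + q \<theta>) \<in> ?S" if "p \<in> C" "q \<in> D" for p q
    using that by (intro UnI2 CollectI exI[of _ p] exI[of _ q] conjI refl)
  show ?thesis
    unfolding convex_cone_def
  proof (intro conjI ballI allI impI)
    fix u and c :: real assume "u \<in> ?S" "c > 0"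
    then consider "u \<in> C" | "u \<in> D" | p q where "p \<in> C" "q \<in> D" "u = (\<lambda>\<theta>. p \<theta> + q \<theta>)" by blast
    then show "(\<lambda>\<theta>. c * u \<theta>) \<in> ?S"
    proof cases
      case 3
      then have "(\<lambda>\<theta>. c * p \<theta>) \<in> C" "(\<lambda>\<theta>. c * q \<theta>) \<in> D"
        using assms \<open>c > 0\<close> by (simp_all add: convex_cone_def)
      then have "(\<lambda>\<theta>. c * p \<theta> + c * q \<theta>) \<in> ?S" by (rule CD)
      then show ?thesis using 3 by (simp add: distrib_left)
    qed (use assms \<open>c > 0\<close> in \<open>simp_all add: convex_cone_def\<close>)
  next
    note C = convex_cone_add[OF assms(1)] and D = convex_cone_add[OF assms(2)]
    \<comment> \<open>Closure under addition reduces to adding a single element of \<open>C\<close>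
      or of \<open>D\<close>, because any \<open>u\<close> in the set is built from at most one of
      each.\<close>
    have left: "(\<lambda>\<theta>. p \<theta> + u \<theta>) \<in> ?S" if p: "p \<in> C" and u: "u \<in> ?S" for p u
    proof -
      consider "u \<in> C" | "u \<in> D" | p' q where "p' \<in> C" "q \<in> D" "u = (\<lambda>\<theta>. p' \<theta> + q \<theta>)" using u by blast
      then show ?thesis
      proof cases
        case 3
        then show ?thesis using CD[OF C[OF p 3(1)] 3(2)] by (simp add: add.assoc)
      qed (use p C CD in auto)
    qed
    have right: "(\<lambda>\<theta>. q \<theta> + u \<theta>) \<in> ?S" if q: "q \<in> D" and u: "u \<in> ?S" for q u
    proof -
      consider "u \<in> C" | "u \<in> D" | p q' where "p \<in> C" "q' \<in> D" "u = (\<lambda>\<theta>. p \<theta> + q' \<theta>)" using u by blast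
      then show ?thesis
      proof cases
        case 1
        then show ?thesis using CD[OF 1 q] by (simp add: add.commute)
      next
        case 3
        then show ?thesis using CD[OF 3(1) D[OF q 3(2)]] by (simp add: add.left_commute)
      qed (use q D in auto)
    qed
    fix u v assume u: "u \<in> ?S" and v: "v \<in> ?S"
    consider "u \<in> C" | "u \<in> D" | p q where "p \<in> C" "q \<in> D" "u = (\<lambda>\<theta>. p \<theta> + q \<theta>)" using u by blast
    then show "(\<lambda>\<theta>. u \<theta> + v \<theta>) \<in> ?S"
    proof cases
      case 3
      then show ?thesis using left[OF 3(1) right[OF 3(2) v]] by (simp add: add.assoc)
    qed (use left right v in auto)
  qed
qed

text \<open>The witness is the cone generated by \<open>A\<close> and the Bernstein positive
  polynomials. If 0 were in it, then 0 would be in the hull of \<open>A\<close>, or 0 would be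
  Bernstein positive, or some \<open>- p\<close> with \<open>p \<in> posi A\<close> would be; all
  three are excluded.\<close>

lemma bernstein_coherent_superset:
  assumes A: "A \<subseteq> simplex_polys" and avoids: "avoids_bernstein_nonpositivity A"
  shows "\<exists>H. bernstein_coherent H \<and> A \<subseteq> H"
proof (intro exI conjI)
  let ?P = "bernstein_positive :: (('a \<Rightarrow> real) \<Rightarrow> real) set"
  let ?H = "posi A \<union> ?P \<union> {\<lambda>\<theta>. p \<theta> + q \<theta> | p q. p \<in> posi A \<and> q \<in> ?P}"
  have sub: "posi A \<subseteq> simplex_polys" by (rule posi_least[OF convex_cone_simplex_polys A])
  have subP: "?P \<subseteq> simplex_polys" by (auto simp: bernstein_positive_def)
  have H: "?H \<subseteq> simplex_polys" using sub subP simplex_polys_add by blast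
  note avoids = avoids[unfolded avoids_iff[OF A]]
  have "(\<lambda>_. 0) \<noteq> (\<lambda>\<theta>. p \<theta> + q \<theta>)" if "p \<in> posi A" "q \<in> ?P" for p q
  proof
    assume "(\<lambda>_. 0) = (\<lambda>\<theta>. p \<theta> + q \<theta>)"
    then have "p \<theta> + q \<theta> = 0" for \<theta> by metis
    then have "q = (\<lambda>\<theta>. - p \<theta>)" by (simp add: fun_eq_iff add_eq_0_iff)
    then show False using avoids that by blast
  qed
  then have "(\<lambda>_. 0) \<notin> ?H" using avoids zero_notin_bernstein_positive by blast
  then show "bernstein_coherent ?H"
    using H convex_cone_sum[OF convex_cone_posi convex_cone_bernstein_positive]
    unfolding bernstein_coherent_iff by blast
  show "A \<subseteq> ?H" using subset_posi by blast
qed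

text \<open>The closure conditions pass to intersections; the one known superset \<open>H\<close>
  keeps 0 out and the intersection inside \<open>simplex_polys\<close>.\<close>

lemma bernstein_coherent_natural_extension:
  assumes "bernstein_coherent H" "A \<subseteq> H"
  shows "bernstein_coherent (bernstein_natural_extension A)"
    and "A \<subseteq> bernstein_natural_extension A"
    and "bernstein_natural_extension A \<subseteq> H"
proof -
  let ?\<H> = "{H. bernstein_coherent H \<and> A \<subseteq> H}"
  have H: "H \<in> ?\<H>" "H \<subseteq> simplex_polys" using assms by (auto simp: bernstein_coherent_iff)
  then have E: "bernstein_natural_extension A = \<Inter>?\<H>"
    unfolding bernstein_natural_extension_def by blast
  show "bernstein_natural_extension A \<subseteq> H" "A \<subseteq> bernstein_natural_extension A"
    unfolding E using H by blast+
  have "convex_cone (\<Inter>?\<H>)"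
    unfolding convex_cone_def by (auto simp: bernstein_coherent_iff convex_cone_def)
  then show "bernstein_coherent (bernstein_natural_extension A)"
    unfolding E using H by (auto simp: bernstein_coherent_iff)
qed

section \<open>Families of sets of desirable gambles\<close>

definition family_of :: "(('x::finite \<Rightarrow> real) \<Rightarrow> real) set \<Rightarrow> nat \<Rightarrow> ('x list \<Rightarrow> real) set" where
  "family_of H k = {f \<in> gambles (seqs k). Mn k f \<in> H}"

text \<open>Each requirement mirrors a property of \<open>Mn\<close>: linearity gives the cone
  conditions, \<open>Mn_permute\<close> exchangeability and \<open>Mn_extend\<close> time
  consistency.\<close>

lemma family_of_consistent:
  fixes H :: "(('x::finite \<Rightarrow> real) \<Rightarrow> real) set"
  assumes H: "bernstein_coherent H"
  shows "coh_exch_time_consistent (family_of H)"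
proof -
  have "coherent_set (seqs k) (family_of H k)" if "k \<ge> 1" for k
    unfolding coherent_set_def
  proof (intro conjI ballI allI impI)
    fix f :: "'x list \<Rightarrow> real" assume "f \<in> gambles (seqs k)" "f > (\<lambda>_. 0)"
    then have "Mn k f \<in> bernstein_positive" using that unfolding bernstein_positive_iff by blast
    then show "f \<in> family_of H k"
      using H \<open>f \<in> gambles (seqs k)\<close> by (auto simp: family_of_def bernstein_coherent_iff)
  next
    fix f and c :: real assume "f \<in> family_of H k" "c > 0"
    then show "(\<lambda>x. c * f x) \<in> family_of H k"
      using H by (simp add: family_of_def gambles_seqs Mn_scale bernstein_coherent_iff convex_cone_def)
  next
    fix f g assume "f \<in> family_of H k" "g \<in> family_of H k"
    then show "(\<lambda>x. f x + g x) \<in> family_of H k"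
      using H by (simp add: family_of_def gambles_seqs Mn_add bernstein_coherent_iff convex_cone_def)
  qed (use H in \<open>auto simp: family_of_def Mn_zero bernstein_coherent_iff\<close>)
  moreover have "exchangeable k (family_of H k)" for k
    unfolding exchangeable_def
  proof (intro ballI allI impI)
    fix h f :: "'x list \<Rightarrow> real" and \<pi>
    assume h: "h \<in> family_of H k" and f: "f \<in> gambles (seqs k)" and \<pi>: "\<pi> permutes {..<k}"
    let ?g = "\<lambda>x. h x + (f x - (f \<circ> permute_list \<pi>) x)"
    have "Mn k ?g = Mn k h"
      by (simp only: Mn_add Mn_diff Mn_permute[OF \<pi>]) simp
    moreover have "?g \<in> gambles (seqs k)"
      using h f by (simp add: family_of_def gambles_seqs)
    ultimately show "?g \<in> family_of H k" using h by (simp add: family_of_def)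
  qed
  moreover have "extend_gamble n1 n2 ` family_of H n1 =
      family_of H n2 \<inter> extend_gamble n1 n2 ` gambles (seqs n1)" if "n1 \<le> n2" for n1 n2
    using that by (auto simp: family_of_def Mn_extend extend_gamble_gamble)
  ultimately show ?thesis by (simp add: coh_exch_time_consistent_def)
qed

lemma frequency_representation_family_of:
  assumes "H \<subseteq> simplex_polys"
  shows "frequency_representation (family_of H) = H"
proof -
  have "p \<in> frequency_representation (family_of H)" if p: "p \<in> H" for p
  proof -
    obtain k f where "k \<ge> 1" "f \<in> gambles (seqs k)" "p = Mn k f"
      using simplex_polys_eq_Mn[of p] assms p by blast
    then show ?thesis using p unfolding frequency_representation_def family_of_def by blast
  qed
  moreover have "frequency_representation (family_of H) \<subseteq> H"
    by (auto simp: frequency_representation_def family_of_def)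
  ultimately show ?thesis by blast
qed

section \<open>Consistent families as preimages of their frequency representations\<close>

context
  fixes R :: "nat \<Rightarrow> ('x::finite list \<Rightarrow> real) set"
  assumes R: "coh_exch_time_consistent R"
begin

lemma consistent_coherent: "k \<ge> 1 \<Longrightarrow> coherent_set (seqs k) (R k)"
  using R by (simp add: coh_exch_time_consistent_def)

lemma consistent_extend:
  "f \<in> R k \<Longrightarrow> 1 \<le> k \<Longrightarrow> k \<le> N \<Longrightarrow> extend_gamble k N f \<in> R N"
  using R unfolding coh_exch_time_consistent_def by blast

text \<open>Time consistency yields only some member of \<open>R k\<close> with the same extension;
  injectivity of the extension identifies it with \<open>f\<close>.\<close>

lemma consistent_restrict:
  assumes "1 \<le> k" "k \<le> N" "f \<in> gambles (seqs k)" "extend_gamble k N f \<in> R N"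
  shows "f \<in> R k"
proof -
  have "extend_gamble k N f \<in> extend_gamble k N ` R k"
    using R assms unfolding coh_exch_time_consistent_def by blast
  then obtain g where g: "g \<in> R k" "extend_gamble k N f = extend_gamble k N g" by blast
  then have "g \<in> gambles (seqs k)"
    using consistent_coherent[OF assms(1)] by (auto simp: coherent_set_def)
  with g assms show ?thesis using extend_gamble_eqD by metis
qed

text \<open>Gambles \<open>f\<close> and \<open>g\<close> with the same polynomial become, at a
  common level, gambles whose difference is in the kernel of \<open>Mn\<close>. Exchangeability
  absorbs that difference, and time consistency leads back to level \<open>k\<close>. So the
  frequency representation determines the family.\<close>

lemma mem_consistent_iff:
  assumes k: "k \<ge> 1" and f: "f \<in> gambles (seqs k)"
  shows "f \<in> R k \<longleftrightarrow> Mn k f \<in> frequency_representation R"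
proof
  assume "Mn k f \<in> frequency_representation R"
  then obtain j g where j: "j \<ge> 1" and g: "g \<in> R j" and eq: "Mn k f = Mn j g"
    by (auto simp: frequency_representation_def)
  define N where "N = max j k"
  have N: "N \<ge> j" "N \<ge> k" "N \<ge> 1" using j by (auto simp: N_def)
  let ?d = "\<lambda>x. extend_gamble k N f x - extend_gamble j N g x"
  have "?d \<in> gambles (seqs N)"
    using extend_gamble_gamble[of k N f] extend_gamble_gamble[of j N g] by (simp add: gambles_seqs)
  moreover have "Mn N ?d = (\<lambda>_. 0)" using N eq by (simp add: Mn_diff Mn_extend)
  moreover have "exchangeable N (R N)" using R N by (simp add: coh_exch_time_consistent_def)
  ultimately have "(\<lambda>x. extend_gamble j N g x + ?d x) \<in> R N"
    using exchangeable_add_null consistent_extend[OF g j N(1)] by blast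
  then have "extend_gamble k N f \<in> R N" by simp
  then show "f \<in> R k" using consistent_restrict k N f by blast
qed (use k in \<open>auto simp: frequency_representation_def\<close>)

lemma frequency_representation_coherent: "bernstein_coherent (frequency_representation R)"
proof -
  let ?F = "frequency_representation R"
  have memI: "Mn k f \<in> ?F" if "k \<ge> 1" "f \<in> R k" for k f
    using that by (auto simp: frequency_representation_def)
  have "(\<lambda>_. 0) \<notin> ?F"
  proof
    assume "(\<lambda>_. 0) \<in> ?F"
    \<comment> \<open>The zero polynomial might stem from a nonzero gamble at any level;
      \<open>mem_consistent_iff\<close> transfers it to the zero gamble at level 1.\<close>
    then have "Mn 1 (\<lambda>_ :: 'x list. 0) \<in> ?F" by (simp add: Mn_zero)
    then have "(\<lambda>_. 0) \<in> R 1" by (subst mem_consistent_iff) (simp_all add: gambles_seqs)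
    then show False using consistent_coherent[of 1] by (simp add: coherent_set_def)
  qed
  moreover have "bernstein_positive \<subseteq> ?F"
  proof
    fix p :: "('x \<Rightarrow> real) \<Rightarrow> real" assume "p \<in> bernstein_positive"
    then obtain r f where "r \<ge> 1" "f \<in> gambles (seqs r)" "f > (\<lambda>_. 0)" "p = Mn r f"
      unfolding bernstein_positive_iff by blast
    then show "p \<in> ?F"
      using consistent_coherent[of r] memI unfolding coherent_set_def by blast
  qed
  moreover have "convex_cone ?F"
    unfolding convex_cone_def
  proof (intro conjI ballI allI impI)
    fix p and c :: real assume "p \<in> ?F" "c > 0"
    then obtain k f where k: "k \<ge> 1" "f \<in> R k" "p = Mn k f"
      by (auto simp: frequency_representation_def)
    then have "(\<lambda>x. c * f x) \<in> R k"
      using consistent_coherent[of k] \<open>c > 0\<close> by (simp add: coherent_set_def)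
    from memI[OF k(1) this] show "(\<lambda>\<theta>. c * p \<theta>) \<in> ?F" by (simp add: Mn_scale k(3))
  next
    fix p q assume "p \<in> ?F" "q \<in> ?F"
    then obtain j f k g where j: "j \<ge> 1" "f \<in> R j" "p = Mn j f" and k: "k \<ge> 1" "g \<in> R k" "q = Mn k g"
      by (auto simp: frequency_representation_def)
    have N: "max j k \<ge> 1" using j by simp
    have "extend_gamble j (max j k) f \<in> R (max j k)" "extend_gamble k (max j k) g \<in> R (max j k)"
      using j k by (auto intro: consistent_extend)
    then have "(\<lambda>x. extend_gamble j (max j k) f x + extend_gamble k (max j k) g x) \<in> R (max j k)"
      using consistent_coherent[OF N] by (simp add: coherent_set_def)
    from memI[OF N this] show "(\<lambda>\<theta>. p \<theta> + q \<theta>) \<in> ?F" by (simp add: j(3) k(3) Mn_add_levels)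
  qed
  moreover have "?F \<subseteq> simplex_polys"
    by (auto simp: frequency_representation_def Mn_simplex_poly)
  ultimately show ?thesis by (simp add: bernstein_coherent_iff)
qed

end

theorem theorem28:
  fixes A :: "('x::finite list \<Rightarrow> real) set" and n :: nat
  assumes "n \<ge> 1" and "A \<subseteq> gambles (seqs n)"
  shows "((\<exists>R. extends_to n A R) \<longleftrightarrow> avoids_bernstein_nonpositivity (Mn n ` A)) \<and>
    (avoids_bernstein_nonpositivity (Mn n ` A) \<longrightarrow>
       (\<exists>R. most_conservative_extension n A R) \<and>
       (\<forall>R. most_conservative_extension n A R \<longrightarrow>
          frequency_representation R = bernstein_natural_extension (Mn n ` A)))"
proof -
  let ?M = "Mn n ` A" and ?E = "bernstein_natural_extension (Mn n ` A)"
  have polys: "?M \<subseteq> simplex_polys" by (auto simp: Mn_simplex_poly)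
  \<comment> \<open>This serves twice: for necessity of the condition, and for minimality, since the
    natural extension lies below every such set.\<close>
  have freq: "bernstein_coherent (frequency_representation R)" "?M \<subseteq> frequency_representation R"
    if "extends_to n A R" for R
    using that assms(1) frequency_representation_coherent[of R]
    by (auto simp: extends_to_def frequency_representation_def)
  have least: "most_conservative_extension n A (family_of ?E)"
    and freq_E: "frequency_representation (family_of ?E) = ?E"
    if avoids: "avoids_bernstein_nonpositivity ?M"
  proof -
    obtain H where H: "bernstein_coherent H" "?M \<subseteq> H"
      using bernstein_coherent_superset[OF polys avoids] by blast
    note E = bernstein_coherent_natural_extension[OF H]
    show "frequency_representation (family_of ?E) = ?E"
      using E(1) by (intro frequency_representation_family_of) (simp add: bernstein_coherent_iff)
    have "extends_to n A (family_of ?E)"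
      using family_of_consistent[OF E(1)] E(2) assms(2) by (auto simp: extends_to_def family_of_def)
    \<comment> \<open>The frequency representation of \<open>S\<close> is one of the intersected
      sets, so it includes \<open>?E\<close>; \<open>mem_consistent_iff\<close> turns this inclusion
      into one of gambles.\<close>
    moreover have "family_of ?E k \<subseteq> S k" if S: "extends_to n A S" and k: "k \<ge> 1" for S k
    proof
      fix f assume "f \<in> family_of ?E k"
      then have "f \<in> gambles (seqs k)" "Mn k f \<in> frequency_representation S"
        using bernstein_coherent_natural_extension(3)[OF freq[OF S]] by (auto simp: family_of_def)
      then show "f \<in> S k"
        using mem_consistent_iff[of S k f] S k by (simp add: extends_to_def)
    qed
    ultimately show "most_conservative_extension n A (family_of ?E)"
      by (simp add: most_conservative_extension_def)
  qed
  have "frequency_representation R = ?E"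
    if avoids: "avoids_bernstein_nonpositivity ?M" and R: "most_conservative_extension n A R" for R
  proof -
    \<comment> \<open>Two smallest families may still differ at index 0, which
      \<open>frequency_representation\<close> does not see.\<close>
    have "R k = family_of ?E k" if "k \<ge> 1" for k
      using R least[OF avoids] that unfolding most_conservative_extension_def
      by (intro subset_antisym) blast+
    then have "frequency_representation R = frequency_representation (family_of ?E)"
      by (auto simp: frequency_representation_def)
    then show ?thesis using freq_E[OF avoids] by simp
  qed
  moreover have "(\<exists>R. extends_to n A R) \<longleftrightarrow> avoids_bernstein_nonpositivity ?M"
  proof
    assume "\<exists>R. extends_to n A R"
    then obtain R where "extends_to n A R" ..
    from bernstein_coherent_avoids[OF freq[OF this]] show "avoids_bernstein_nonpositivity ?M" .
  next
    assume "avoids_bernstein_nonpositivity ?M"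
    from least[OF this] show "\<exists>R. extends_to n A R"
      unfolding most_conservative_extension_def by (elim conjE exI[of _ "family_of ?E"])
  qed
  moreover have "\<exists>R. most_conservative_extension n A R" if "avoids_bernstein_nonpositivity ?M"
    by (rule exI[of _ "family_of ?E"]) (rule least[OF that])
  ultimately show ?thesis by simp
qed

end
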